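(* Let $n,m,z$ be positive integers with $z\le n$, and let $A\in\mathbb{R}^{n\times n}$, $B\in\mathbb{R}^{n\times m}$, $C\in\mathbb{R}^{z\times n}$. The observability of the Caputo fractional differential system $$\left({}^{C}D_{0+}^{\alpha}x_\alpha\right)(\tau)=Ax_\alpha(\tau)+Bu(\tau),\qquad y_\alpha(\tau)=Cx_\alpha(\tau),$$ is independent of the real order $\alpha>0$ (where $k-1<\alpha\le k$, $k$ any positive integer) and independent of the observation interval, provided it has nonzero measure. That is, for all real $\alpha,\alpha'>0$ and all finite $t,t'>0$, the system of order $\alpha$ is observable in $[0,t]$ if and only if the system of order $\alpha'$ (with the same $A,B,C$) is observable in $[0,t']$.
   Context: For real $\alpha>0$ let $k$ be the positive integer with $k-1<\alpha\le k$. The system of order $\alpha$ is given initial conditions $x_\alpha^{(j)}(0)=x_{0j}\in\mathbb{R}^n$, $j=0,1,\dots,k-1$. Admissible controls $u:[0,\infty)\to\mathbb{R}^m$ are bounded piecewise continuous functions. For each such $u$ and each set of initial conditions, the unique solution of the Caputo system on $[0,\infty)$ is $$x_\alpha(t)=\sum_{j=0}^{k-1}t^{j}\Phi_{\alpha j}(t)x_{0j}+\int_0^t(t-\tau)^{\alpha-1}\Phi_\alpha(t-\tau)Bu(\tau)\,d\tau,$$ $$\Phi_{\alpha j}(t)=\sum_{\ell=0}^{\infty}\frac{A^\ell t^{\alpha\ell}}{\Gamma(\alpha\ell+j+1)},\qquad \Phi_\alpha(t)=\sum_{\ell=0}^{\infty}\frac{A^\ell t^{\alpha\ell}}{\Gamma(\alpha(\ell+1))},$$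 where $\Gamma$ is the Gamma function. The system of order $\alpha$ is observable in the observation interval $[0,t]$, $t>0$, if the initial conditions $x_{00},\dots,x_{0,k-1}$ can be uniquely determined from the output $y_\alpha(\tau)$, $\tau\in[0,t]$, the control $u$ being known; that is, for a given admissible $u$, two sets of initial conditions producing the same output on $[0,t]$ coincide. *)

theory Defs
  imports "HOL-Analysis.Analysis"
begin

text \<open>
  Signals live on the half-line \<open>[0, \<infinity>)\<close>, so derivatives are taken within \<open>{0..}\<close>; they are
  one-sided at \<open>0\<close>, and the values of a function at negative arguments are irrelevant.
\<close>

definition hderiv :: "(real \<Rightarrow> 'a::real_normed_vector) \<Rightarrow> real \<Rightarrow> 'a" where
  "hderiv f t = vector_derivative f (at t within {0..})"

text \<open>\<open>f\<close> is \<open>r\<close> times continuously differentiable on \<open>[0, \<infinity>)\<close>.\<close>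

definition hsmooth :: "nat \<Rightarrow> (real \<Rightarrow> 'a::real_normed_vector) \<Rightarrow> bool" where
  "hsmooth r f \<longleftrightarrow>
     (\<forall>i<r. \<forall>t\<ge>0. (hderiv ^^ i) f differentiable (at t within {0..})) \<and>
     continuous_on {0..} ((hderiv ^^ r) f)"

text \<open>The Riemann--Liouville fractional integral \<open>I\<^sub>0\<^sub>+\<^sup>\<beta>\<close>, with \<open>I\<^sub>0\<^sub>+\<^sup>0\<close> the identity.\<close>

definition rl_integral :: "real \<Rightarrow> (real \<Rightarrow> 'a::euclidean_space) \<Rightarrow> real \<Rightarrow> 'a" where
  "rl_integral \<beta> f t =
     (if \<beta> = 0 then f t
      else (1 / Gamma \<beta>) *\<^sub>R integral {0..t} (\<lambda>s. (t - s) powr (\<beta> - 1) *\<^sub>R f s))"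

text \<open>For \<open>\<alpha> > 0\<close>, the positive integer \<open>k\<close> with \<open>k - 1 < \<alpha> \<le> k\<close>.\<close>

definition ceil_order :: "real \<Rightarrow> nat" where
  "ceil_order \<alpha> = nat \<lceil>\<alpha>\<rceil>"

text \<open>
  The Caputo derivative in the form of Kilbas, Srivastava and Trujillo and of Diethelm: the
  Riemann--Liouville derivative \<open>(d/dt)\<^sup>k I\<^sub>0\<^sub>+\<^sup>k\<^sup>-\<^sup>\<alpha>\<close> of \<open>x\<close> minus its Taylor polynomial of degree
  \<open>k - 1\<close> at \<open>0\<close>. It agrees with \<open>I\<^sub>0\<^sub>+\<^sup>k\<^sup>-\<^sup>\<alpha> x\<^sup>(\<^sup>k\<^sup>)\<close> whenever \<open>x\<^sup>(\<^sup>k\<^sup>-\<^sup>1\<^sup>)\<close> is absolutely continuous, and for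
  \<open>\<alpha> = k\<close> it is \<open>x\<^sup>(\<^sup>k\<^sup>)\<close>. The weaker form is needed here: for a control that is only piecewise
  continuous, \<open>x\<^sup>(\<^sup>k\<^sup>)\<close> may fail to exist.
\<close>

definition caputo_pre :: "real \<Rightarrow> (real \<Rightarrow> 'a::euclidean_space) \<Rightarrow> real \<Rightarrow> 'a" where
  "caputo_pre \<alpha> x =
     rl_integral (real (ceil_order \<alpha>) - \<alpha>)
       (\<lambda>s. x s - (\<Sum>j<ceil_order \<alpha>. (s ^ j / fact j) *\<^sub>R (hderiv ^^ j) x 0))"

definition caputo_deriv :: "real \<Rightarrow> (real \<Rightarrow> 'a::euclidean_space) \<Rightarrow> real \<Rightarrow> 'a" where
  "caputo_deriv \<alpha> x = (hderiv ^^ ceil_order \<alpha>) (caputo_pre \<alpha> x)"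

definition caputo_differentiable ::
  "real \<Rightarrow> (real \<Rightarrow> 'a::euclidean_space) \<Rightarrow> real \<Rightarrow> bool" where
  "caputo_differentiable \<alpha> x t \<longleftrightarrow>
     (hderiv ^^ (ceil_order \<alpha> - 1)) (caputo_pre \<alpha> x) differentiable (at t within {0..})"

text \<open>
  Bounded and piecewise continuous on \<open>[0, \<infinity>)\<close>: on every compact interval there are finitely many
  discontinuities, and all one-sided limits exist.
\<close>

definition admissible_control :: "(real \<Rightarrow> 'a::real_normed_vector) \<Rightarrow> bool" where
  "admissible_control u \<longleftrightarrow>
     bounded (u ` {0..}) \<and>
     (\<forall>T>0. finite {t \<in> {0..T}. \<not> continuous (at t within {0..}) u}) \<and>
     (\<forall>t\<ge>0. \<exists>l. (u \<longlongrightarrow> l) (at_right t)) \<and>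
     (\<forall>t>0. \<exists>l. (u \<longlongrightarrow> l) (at_left t))"

text \<open>
  Solutions on \<open>[0, \<infinity>)\<close> with initial values \<open>x\<^sup>(\<^sup>j\<^sup>)(0) = x0 j\<close> for \<open>j < k\<close>. As usual for
  discontinuous controls, the equation is required at the points of continuity of \<open>u\<close>; continuity
  of the first \<open>k - 1\<close> derivatives of \<^term>\<open>caputo_pre \<alpha> x\<close> excludes jumps at the others.
\<close>

definition caputo_solution ::
  "real \<Rightarrow> real^'n^'n \<Rightarrow> real^'m^'n \<Rightarrow> (real \<Rightarrow> real^'m) \<Rightarrow> (nat \<Rightarrow> real^'n) \<Rightarrow> (real \<Rightarrow> real^'n) \<Rightarrow> bool"
  where
  "caputo_solution \<alpha> A B u x0 x \<longleftrightarrow>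
     hsmooth (ceil_order \<alpha> - 1) x \<and>
     (\<forall>j<ceil_order \<alpha>. (hderiv ^^ j) x 0 = x0 j) \<and>
     hsmooth (ceil_order \<alpha> - 1) (caputo_pre \<alpha> x) \<and>
     (\<forall>t>0. continuous (at t within {0..}) u \<longrightarrow>
        caputo_differentiable \<alpha> x t \<and> caputo_deriv \<alpha> x t = A *v x t + B *v u t)"

definition observable ::
  "real \<Rightarrow> real^'n^'n \<Rightarrow> real^'m^'n \<Rightarrow> real^'n^'z \<Rightarrow> real \<Rightarrow> bool" where
  "observable \<alpha> A B C t \<longleftrightarrow>
     (\<forall>u x0 x0' x x'.
        admissible_control u \<longrightarrow>
        caputo_solution \<alpha> A B u x0 x \<longrightarrow>
        caputo_solution \<alpha> A B u x0' x' \<longrightarrow>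
        (\<forall>\<tau>\<in>{0..t}. C *v x \<tau> = C *v x' \<tau>) \<longrightarrow>
        (\<forall>j<ceil_order \<alpha>. x0 j = x0' j))"

end

theory Submission imports Defs begin

text \<open>
  For every order and every interval, observability is equivalent to Kalman's condition that
  \<open>C A\<^sup>l v = 0\<close> for all \<open>l\<close> forces \<open>v = 0\<close>, in which neither \<open>\<alpha>\<close> nor \<open>t\<close> occurs.

  If \<open>v \<noteq> 0\<close> violates Kalman's condition, then with \<open>u = 0\<close> the solution
  \<open>\<Sum>\<^sub>l t\<^sup>\<alpha>\<^sup>l\<^sup>+\<^sup>k\<^sup>-\<^sup>1 A\<^sup>l v / \<Gamma>(\<alpha> l + k)\<close> with \<open>x\<^sup>(\<^sup>k\<^sup>-\<^sup>1\<^sup>)(0) = v\<close> has the same zero output as the zero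
  solution. Conversely, suppose that two solutions satisfy \<open>L x = L x'\<close> on \<open>[0, t]\<close> for a linear map \<open>L\<close>.
  Since the Caputo derivative commutes with \<open>L\<close> and at \<open>s\<close> depends only on the values up to and
  near \<open>s\<close>, the equation gives \<open>L A x = L A x'\<close> at the points of continuity of \<open>u\<close>, hence on all of
  \<open>[0, t]\<close>. Iterating from \<open>L = C\<close> yields \<open>C A\<^sup>l (x - x') = 0\<close>, so that \<open>x = x'\<close> on \<open>[0, t]\<close>; the
  explicit solution formula and uniqueness of solutions are not needed.
\<close>

section \<open>Derivatives on the half-line\<close>

lemma at_within_Ici_neq_bot: "at t within {0..} \<noteq> bot" if "0 \<le> t" for t :: real
proof -
  have "t islimpt {t..t+1}" by simp
  then have "t islimpt {0..}" by (rule islimpt_subset) (use that in auto)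
  then show ?thesis by (simp add: trivial_limit_within)
qed

lemma hderiv_eqI:
  assumes "(f has_vector_derivative D) (at t within {0..})" "0 \<le> t"
  shows "hderiv f t = D"
  unfolding hderiv_def using assms at_within_Ici_neq_bot by (blast intro: vector_derivative_within)

lemma has_vector_derivative_hderiv:
  assumes "f differentiable (at t within {0..})"
  shows "(f has_vector_derivative hderiv f t) (at t within {0..})"
  using assms by (simp add: hderiv_def vector_derivative_works)

text \<open>Every point of the open set \<open>S\<close> has a neighbourhood inside
  \<open>S\<close>, so equality on the nonnegative part of \<open>S\<close> survives each
  differentiation. Taking \<open>S = {..<t}\<close> with \<open>t > 0\<close> also covers the
  one-sided derivatives at 0.\<close>

lemma hderiv_funpow_cong:
  assumes "open S" "\<And>s. s \<in> S \<Longrightarrow> 0 \<le> s \<Longrightarrow> f s = g s" "t \<in> S" "0 \<le> t"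
  shows "(hderiv ^^ i) f t = (hderiv ^^ i) g t"
  using assms(3,4)
proof (induction i arbitrary: t)
  case 0
  then show ?case using assms(2) by simp
next
  case (Suc i)
  have "\<forall>\<^sub>F s in nhds t. s \<in> {0..} \<longrightarrow> (hderiv ^^ i) f s = (hderiv ^^ i) g s"
    using eventually_nhds_in_open[OF assms(1) Suc.prems(1)]
    by eventually_elim (use Suc.IH in auto)
  then have "hderiv ((hderiv ^^ i) f) t = hderiv ((hderiv ^^ i) g) t"
    unfolding hderiv_def[of "(hderiv ^^ i) f"] hderiv_def[of "(hderiv ^^ i) g"]
    by (rule vector_derivative_cong_eq) (use Suc.prems in auto)
  then show ?case by simp
qed

text \<open>Uniqueness of the derivative within \<open>{0..}\<close> identifies the iterates of the
  choice operator \<open>hderiv\<close> with an explicit chain \<open>g 0\<close>,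
  \<open>g 1\<close>, and so on.\<close>

lemma hderiv_funpow_eqI:
  assumes "\<And>t. 0 \<le> t \<Longrightarrow> f t = g 0 t"
    and "\<And>i t. i < r \<Longrightarrow> 0 \<le> t \<Longrightarrow>
           (g i has_vector_derivative g (Suc i) t) (at t within {0..})"
    and "i \<le> r" "0 \<le> t"
  shows "(hderiv ^^ i) f t = g i t"
  using assms(3,4)
proof (induction i arbitrary: t)
  case 0
  then show ?case using assms(1) by simp
next
  case (Suc i)
  have "((hderiv ^^ i) f has_vector_derivative g (Suc i) t) (at t within {0..})"
    by (rule has_vector_derivative_transform[OF _ _ assms(2)]) (use Suc in auto)
  then show ?case using Suc.prems by (simp add: hderiv_eqI)
qed

lemma hsmoothI:
  assumes f: "\<And>t. 0 \<le> t \<Longrightarrow> f t = g 0 t"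
    and g: "\<And>i t. i < r \<Longrightarrow> 0 \<le> t \<Longrightarrow>
           (g i has_vector_derivative g (Suc i) t) (at t within {0..})"
    and cont: "continuous_on {0..} (g r)"
  shows "hsmooth r f"
  unfolding hsmooth_def
proof (intro conjI allI impI)
  have eq: "(hderiv ^^ i) f t = g i t" if "i \<le> r" "0 \<le> t" for i t
    using f g that by (rule hderiv_funpow_eqI)
  fix i t assume "i < r" "(0::real) \<le> t"
  then have "((hderiv ^^ i) f has_vector_derivative g (Suc i) t) (at t within {0..})"
    by (intro has_vector_derivative_transform[OF _ _ g]) (auto intro: eq)
  then show "(hderiv ^^ i) f differentiable (at t within {0..})"
    by (rule differentiableI_vector)
next
  show "continuous_on {0..} ((hderiv ^^ r) f)"
    by (rule continuous_on_eq[OF cont], rule sym, rule hderiv_funpow_eqI[OF f g]) auto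
qed

lemma hderiv_funpow_linear:
  assumes L: "bounded_linear L"
    and diff: "\<And>j s. j < i \<Longrightarrow> 0 \<le> s \<Longrightarrow> (hderiv ^^ j) f differentiable (at s within {0..})"
    and "0 \<le> t"
  shows "(hderiv ^^ i) (\<lambda>s. L (f s)) t = L ((hderiv ^^ i) f t)"
proof (rule hderiv_funpow_eqI[of _ "\<lambda>i s. L ((hderiv ^^ i) f s)"])
  fix j s assume "j < i" "(0::real) \<le> s"
  then show "((\<lambda>s. L ((hderiv ^^ j) f s)) has_vector_derivative L ((hderiv ^^ Suc j) f s))
      (at s within {0..})"
    using bounded_linear.has_vector_derivative[OF L has_vector_derivative_hderiv[OF diff]]
    by simp
qed (use \<open>0 \<le> t\<close> in auto)

lemma has_vector_derivative_integral_Ici: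
  fixes f :: "real \<Rightarrow> 'a::banach"
  assumes f: "continuous_on {0..} f" and "0 \<le> t"
  shows "((\<lambda>s. integral {0..s} f) has_vector_derivative f t) (at t within {0..})"
proof -
  have "((\<lambda>s. integral {0..s} f) has_vector_derivative f t) (at t within {0..t+1})"
    by (rule integral_has_vector_derivative) (use assms in \<open>auto intro: continuous_on_subset\<close>)
  moreover have "at t within {0..t+1} = at t within {0..}"
    by (rule at_within_nhd[of _ "{..<t+1}"]) auto
  ultimately show ?thesis by simp
qed

section \<open>Growth of Gamma and weakly singular kernels\<close>

text \<open>Restrict Euler's integral to \<open>s \<ge> R\<close> and bound the power there by its
  value at \<open>R\<close>. As \<open>R\<close> is free, the bound beats any prescribed geometric
  rate.\<close>

lemma Gamma_lower_bound:
  fixes x R :: real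
  assumes "1 \<le> x" "0 < R"
  shows "R powr (x - 1) * exp (- R) \<le> Gamma x"
proof (rule has_integral_le)
  have "((\<lambda>s. exp (- 1 * s)) has_integral exp (- 1 * R) / 1) {R..}"
    by (rule has_integral_exp_minus_to_infinity) simp
  from has_integral_mult_right[OF this, of "R powr (x - 1)"]
  have "((\<lambda>s. R powr (x - 1) * exp (- s)) has_integral R powr (x - 1) * exp (- R)) {R..}"
    by simp
  then show "((\<lambda>s. if s \<in> {R..} then R powr (x - 1) * exp (- s) else 0) has_integral
      R powr (x - 1) * exp (- R)) {0..}"
    by (subst has_integral_restrict) (use assms in auto)
  show "((\<lambda>s. s powr (x - 1) / exp s) has_integral Gamma x) {0..}"
    by (rule Gamma_integral_real) (use assms in simp)
  fix s :: real assume "s \<in> {0..}"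
  then show "(if s \<in> {R..} then R powr (x - 1) * exp (- s) else 0) \<le> s powr (x - 1) / exp s"
    using assms by (auto simp: exp_minus divide_simps intro: powr_mono2)
qed

lemma summable_powr_div_Gamma:
  fixes \<alpha> \<gamma> K t :: real
  assumes "0 < \<alpha>" "0 \<le> \<gamma>" "0 \<le> K" "0 \<le> t"
  shows "summable (\<lambda>l. t powr (\<alpha> * real l + \<gamma>) / Gamma (\<alpha> * real l + \<gamma> + 1) * K ^ l)"
proof (cases "t = 0")
  case False
  \<comment> \<open>\<open>q\<close> makes \<open>q * K\<close> at most 1/2, with
    \<open>K + 1\<close> covering \<open>K = 0\<close>; \<open>R\<close> is solved from
    \<open>(t / R) powr \<alpha> = q\<close>. The Gamma bound at this \<open>R\<close> then gives a
    multiple of \<open>(1 / 2) ^ l\<close> as majorant.\<close>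
  define q where "q = 1 / (2 * (K + 1))"
  define R where "R = t / q powr (1 / \<alpha>)"
  have q: "0 < q" "q * K \<le> 1 / 2" using assms by (auto simp: q_def field_simps)
  have t: "0 < t" and R: "0 < R" using False assms q by (auto simp: R_def)
  have tR: "(t / R) powr \<alpha> = q"
    using t q assms by (simp add: R_def powr_powr)
  have bound: "norm (t powr (\<alpha> * real l + \<gamma>) / Gamma (\<alpha> * real l + \<gamma> + 1) * K ^ l)
      \<le> exp R * (t / R) powr \<gamma> * (1 / 2) ^ l" for l
  proof -
    have ge: "R powr (\<alpha> * real l + \<gamma>) * exp (- R) \<le> Gamma (\<alpha> * real l + \<gamma> + 1)"
      using Gamma_lower_bound[of "\<alpha> * real l + \<gamma> + 1" R] assms R by simp
    have pos: "0 < R powr (\<alpha> * real l + \<gamma>) * exp (- R)" using R by simp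
    have "norm (t powr (\<alpha> * real l + \<gamma>) / Gamma (\<alpha> * real l + \<gamma> + 1) * K ^ l)
        = t powr (\<alpha> * real l + \<gamma>) / Gamma (\<alpha> * real l + \<gamma> + 1) * K ^ l"
      using assms ge pos by (simp add: abs_mult)
    also have "\<dots> \<le> t powr (\<alpha> * real l + \<gamma>) / (R powr (\<alpha> * real l + \<gamma>) * exp (- R)) * K ^ l"
      using ge pos assms by (intro mult_right_mono divide_left_mono mult_pos_pos) auto
    also have "\<dots> = exp R * (t / R) powr (\<alpha> * real l + \<gamma>) * K ^ l"
      using t R by (simp add: powr_divide exp_minus field_simps)
    also have "(t / R) powr (\<alpha> * real l + \<gamma>) = (t / R) powr \<gamma> * q ^ l"
      using t R q by (simp add: powr_add powr_powr[symmetric] tR powr_realpow)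
    also have "exp R * ((t / R) powr \<gamma> * q ^ l) * K ^ l = exp R * (t / R) powr \<gamma> * (q * K) ^ l"
      by (simp add: power_mult_distrib mult_ac)
    also have "\<dots> \<le> exp R * (t / R) powr \<gamma> * (1 / 2) ^ l"
      using q assms by (intro mult_left_mono power_mono) auto
    finally show ?thesis .
  qed
  show ?thesis
    by (rule summable_comparison_test'[OF _ bound])
       (intro summable_mult summable_geometric, simp)
qed simp

text \<open>This is Euler's Beta integral rescaled from the unit interval to
  \<open>{0..t}\<close>.\<close>

lemma has_integral_powr_convolution:
  fixes a b t :: real
  assumes "0 < a" "0 < b" "0 \<le> t"
  shows "((\<lambda>s. (t - s) powr (b - 1) * s powr (a - 1)) has_integral
           Beta a b * t powr (a + b - 1)) {0..t}"
proof (cases "t = 0")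
  case False
  then have t: "0 < t" using assms by simp
  have "((\<lambda>s. s powr (a - 1) * (1 - s) powr (b - 1)) has_integral Beta a b) (cbox 0 1)"
    using has_integral_Beta_real assms by simp
  from has_integral_affinity'[OF this, of "1 / t" 0]
  have "((\<lambda>s. (s / t) powr (a - 1) * (1 - s / t) powr (b - 1)) has_integral t * Beta a b) {0..t}"
    using t by (simp add: field_simps)
  \<comment> \<open>This factor undoes the scaling of the two powers; the Jacobian contributes the
    remaining factor \<open>t\<close>.\<close>
  from has_integral_mult_right[OF this, of "t powr (a + b - 2)"]
  have "((\<lambda>s. t powr (a + b - 2) * ((s / t) powr (a - 1) * (1 - s / t) powr (b - 1)))
      has_integral Beta a b * t powr (a + b - 1)) {0..t}"
    using t by (simp add: powr_diff mult_ac power2_eq_square)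
  then show ?thesis
  proof (rule has_integral_eq[rotated])
    fix s assume s: "s \<in> {0..t}"
    have "1 - s / t = (t - s) / t" using t by (simp add: field_simps)
    moreover have "t powr (a + b - 2) = t powr (a - 1) * t powr (b - 1)"
      by (simp add: powr_add[symmetric])
    ultimately show "t powr (a + b - 2) * ((s / t) powr (a - 1) * (1 - s / t) powr (b - 1))
        = (t - s) powr (b - 1) * s powr (a - 1)"
      using t s by (simp add: powr_divide)
  qed
qed (use has_integral_refl(2)[of _ "0::real"] in simp)

text \<open>For \<open>b < 1\<close> the kernel blows up near \<open>s = t\<close> but stays
  absolutely integrable, and a bounded measurable factor preserves this.\<close>

lemma integrable_powr_kernel:
  fixes f :: "real \<Rightarrow> 'a::euclidean_space"
  assumes "0 < b" "0 \<le> t" "continuous_on {0..t} f"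
  shows "(\<lambda>s. (t - s) powr (b - 1) *\<^sub>R f s) integrable_on {0..t}"
proof -
  have "(\<lambda>s. (t - s) powr (b - 1)) absolutely_integrable_on {0..t}"
  proof (rule nonnegative_absolutely_integrable_1)
    \<comment> \<open>The Beta integral with \<open>a = 1\<close>: the factor
      \<open>s powr 0\<close> is 1 except at \<open>s = 0\<close>, where it is 0, hence the
      exceptional set \<open>{0}\<close> below.\<close>
    have "((\<lambda>s. (t - s) powr (b - 1) * s powr (1 - 1)) has_integral
           Beta 1 b * t powr (1 + b - 1)) {0..t}"
      using assms by (intro has_integral_powr_convolution) auto
    then have "((\<lambda>s. (t - s) powr (b - 1)) has_integral Beta 1 b * t powr (1 + b - 1)) {0..t}"
      by (rule has_integral_spike_finite[of "{0}", rotated 2]) auto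
    then show "(\<lambda>s. (t - s) powr (b - 1)) integrable_on {0..t}" by blast
  qed auto
  moreover have "f \<in> borel_measurable (lebesgue_on {0..t})"
    using assms by (intro continuous_imp_measurable_on_sets_lebesgue) auto
  moreover have "bounded (f ` {0..t})"
    using assms by (intro compact_imp_bounded compact_continuous_image) auto
  moreover have "bilinear (\<lambda>(y::'a) c. c *\<^sub>R y)"
    unfolding bilinear_def by (intro conjI allI linearI) (simp_all add: algebra_simps)
  ultimately have "(\<lambda>s. (t - s) powr (b - 1) *\<^sub>R f s) absolutely_integrable_on {0..t}"
    by (intro absolutely_integrable_bounded_measurable_product[where h = "\<lambda>y c. c *\<^sub>R y"])
       (simp_all add: fmeasurableD)
  then show ?thesis by (rule set_lebesgue_integral_eq_integral)
qed

section \<open>Mittag-Leffler series\<close>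

text \<open>For \<open>t > 0\<close> this is \<open>t^\<gamma> E(t^\<alpha> T) w\<close> with
  \<open>E\<close> the two-parameter Mittag-Leffler function of indices \<alpha> and
  \<open>\<gamma> + 1\<close>. The power of \<open>t\<close> is absorbed so that fractional
  integration merely shifts \<gamma>.\<close>

definition mittag_leffler ::
  "('a::euclidean_space \<Rightarrow> 'a) \<Rightarrow> real \<Rightarrow> real \<Rightarrow> 'a \<Rightarrow> real \<Rightarrow> 'a" where
  "mittag_leffler T \<alpha> \<gamma> w t =
     (\<Sum>l. (t powr (\<alpha> * real l + \<gamma>) / Gamma (\<alpha> * real l + \<gamma> + 1)) *\<^sub>R (T ^^ l) w)"

lemma norm_funpow_le_onorm:
  fixes T :: "'a::euclidean_space \<Rightarrow> 'a"
  assumes "bounded_linear T"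
  shows "norm ((T ^^ l) w) \<le> onorm T ^ l * norm w"
proof (induction l)
  case (Suc l)
  have "norm ((T ^^ Suc l) w) \<le> onorm T * norm ((T ^^ l) w)"
    by (simp add: onorm[OF assms])
  also have "\<dots> \<le> onorm T * (onorm T ^ l * norm w)"
    using Suc onorm_pos_le[OF assms] by (intro mult_left_mono)
  finally show ?case by (simp add: mult_ac)
qed simp

lemma summable_mittag_leffler_bound:
  fixes T :: "'a::euclidean_space \<Rightarrow> 'a"
  assumes "bounded_linear T" "0 < \<alpha>" "0 \<le> \<gamma>" "0 \<le> t"
  shows "summable (\<lambda>l. t powr (\<alpha> * real l + \<gamma>) / Gamma (\<alpha> * real l + \<gamma> + 1) *
           (onorm T ^ l * norm w))"
  using summable_mult2[OF summable_powr_div_Gamma[OF assms(2-3) onorm_pos_le[OF assms(1)] assms(4)],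
      of "norm w"]
  by (simp add: mult_ac)

text \<open>Taking the majorant at the right end \<open>t\<close> makes it uniform in
  \<open>s\<close>, as the M-test and dominated convergence require.\<close>

lemma norm_mittag_leffler_term_le:
  fixes T :: "'a::euclidean_space \<Rightarrow> 'a"
  assumes "bounded_linear T" "0 < \<alpha>" "0 \<le> \<gamma>" "0 \<le> s" "s \<le> t"
  shows "norm ((s powr (\<alpha> * real l + \<gamma>) / Gamma (\<alpha> * real l + \<gamma> + 1)) *\<^sub>R (T ^^ l) w)
           \<le> t powr (\<alpha> * real l + \<gamma>) / Gamma (\<alpha> * real l + \<gamma> + 1) * (onorm T ^ l * norm w)"
proof -
  have "0 < Gamma (\<alpha> * real l + \<gamma> + 1)"
    using assms by (intro Gamma_real_pos add_nonneg_pos) auto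
  moreover have "s powr (\<alpha> * real l + \<gamma>) \<le> t powr (\<alpha> * real l + \<gamma>)"
    using assms by (intro powr_mono2) auto
  moreover have "0 \<le> onorm T ^ l * norm w"
    using onorm_pos_le[OF assms(1)] by simp
  ultimately show ?thesis
    using norm_funpow_le_onorm[OF assms(1), of l w]
    by (auto intro!: mult_mono divide_right_mono)
qed

lemma summable_mittag_leffler:
  fixes T :: "'a::euclidean_space \<Rightarrow> 'a"
  assumes "bounded_linear T" "0 < \<alpha>" "0 \<le> \<gamma>" "0 \<le> t"
  shows "summable (\<lambda>l. (t powr (\<alpha> * real l + \<gamma>) / Gamma (\<alpha> * real l + \<gamma> + 1)) *\<^sub>R (T ^^ l) w)"
  by (rule summable_comparison_test'[OF summable_mittag_leffler_bound[OF assms]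
        norm_mittag_leffler_term_le[OF assms order_refl]])

lemma continuous_on_mittag_leffler_term:
  fixes T :: "'a::euclidean_space \<Rightarrow> 'a"
  assumes "0 < \<alpha>" "0 < \<gamma>"
  shows "continuous_on {0..}
           (\<lambda>s. (s powr (\<alpha> * real l + \<gamma>) / Gamma (\<alpha> * real l + \<gamma> + 1)) *\<^sub>R (T ^^ l) w)"
proof -
  have pos: "0 < \<alpha> * real l + \<gamma>"
    using assms by (intro add_nonneg_pos) auto
  then have "0 < Gamma (\<alpha> * real l + \<gamma> + 1)"
    by (intro Gamma_real_pos) simp
  then have "Gamma (\<alpha> * real l + \<gamma> + 1) \<noteq> 0"
    by (rule less_imp_neq[THEN not_sym])
  with pos show ?thesis
    by (intro continuous_on_scaleR continuous_on_divide continuous_on_powr' continuous_intros) auto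
qed

text \<open>The series converges uniformly on each \<open>{0..t}\<close>, and
  \<open>{0..t+1}\<close> agrees with the half-line near \<open>t\<close>.\<close>

lemma continuous_on_mittag_leffler:
  assumes "bounded_linear T" "0 < \<alpha>" "0 < \<gamma>"
  shows "continuous_on {0..} (mittag_leffler T \<alpha> \<gamma> w)"
proof -
  have cont: "continuous_on {0..t} (mittag_leffler T \<alpha> \<gamma> w)" if "0 \<le> t" for t
  proof (rule uniform_limit_theorem)
    show "uniform_limit {0..t} (\<lambda>n s. \<Sum>l<n. (s powr (\<alpha> * real l + \<gamma>) /
            Gamma (\<alpha> * real l + \<gamma> + 1)) *\<^sub>R (T ^^ l) w) (mittag_leffler T \<alpha> \<gamma> w) sequentially"
      unfolding mittag_leffler_def
      by (rule Weierstrass_m_test[OF norm_mittag_leffler_term_le summable_mittag_leffler_bound])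
         (use assms that in auto)
    show "\<forall>\<^sub>F n in sequentially. continuous_on {0..t} (\<lambda>s. \<Sum>l<n. (s powr (\<alpha> * real l + \<gamma>) /
            Gamma (\<alpha> * real l + \<gamma> + 1)) *\<^sub>R (T ^^ l) w)"
      by (intro always_eventually allI continuous_on_sum
          continuous_on_subset[OF continuous_on_mittag_leffler_term]) (use assms in auto)
  qed simp
  show ?thesis
    unfolding continuous_on_eq_continuous_within
  proof
    fix t :: real assume t: "t \<in> {0..}"
    have "at t within {0..t+1} = at t within {0..}"
      by (rule at_within_nhd[of _ "{..<t+1}"]) auto
    then show "continuous (at t within {0..}) (mittag_leffler T \<alpha> \<gamma> w)"
      using cont[of "t+1"] t unfolding continuous_on_eq_continuous_within by force
  qed
qed

text \<open>Termwise, the Beta integral raises each exponent by \<beta> and adjusts its Gamma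
  factor; dominated convergence exchanges sum and integral.\<close>

lemma rl_integral_mittag_leffler:
  assumes T: "bounded_linear T" and pos: "0 < \<alpha>" "0 < \<gamma>" "0 \<le> \<beta>" "0 \<le> t"
  shows "rl_integral \<beta> (mittag_leffler T \<alpha> \<gamma> w) t = mittag_leffler T \<alpha> (\<gamma> + \<beta>) w t"
proof (cases "\<beta> = 0")
  case True
  then show ?thesis by (simp add: rl_integral_def)
next
  case False
  with pos have \<beta>: "0 < \<beta>" by simp
  define c where "c l s = (s powr (\<alpha> * real l + \<gamma>) / Gamma (\<alpha> * real l + \<gamma> + 1)) *\<^sub>R (T ^^ l) w"
    for l s
  define d where "d l = (t powr (\<alpha> * real l + (\<gamma> + \<beta>)) / Gamma (\<alpha> * real l + (\<gamma> + \<beta>) + 1)) *\<^sub>R (T ^^ l) w"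
    for l
  define M where "M l = t powr (\<alpha> * real l + \<gamma>) / Gamma (\<alpha> * real l + \<gamma> + 1) * (onorm T ^ l * norm w)"
    for l
  have M: "summable M"
    unfolding M_def by (rule summable_mittag_leffler_bound) (use T pos in auto)
  have cM: "norm (c l s) \<le> M l" if "s \<in> {0..t}" for l s
    unfolding c_def M_def by (rule norm_mittag_leffler_term_le) (use T pos that in auto)
  have partial: "((\<lambda>s. (t - s) powr (\<beta> - 1) *\<^sub>R (\<Sum>l<n. c l s)) has_integral
      Gamma \<beta> *\<^sub>R (\<Sum>l<n. d l)) {0..t}" for n
  proof -
    have "((\<lambda>s. (t - s) powr (\<beta> - 1) *\<^sub>R c l s) has_integral Gamma \<beta> *\<^sub>R d l) {0..t}" for l
    proof -
      \<comment> \<open>With \<open>p\<close> one above the exponent, \<open>Beta p \<beta>\<close>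
        is \<open>Gamma p * Gamma \<beta> / Gamma (p + \<beta>)\<close>; \<open>Gamma p\<close>
        cancels against the coefficient and only \<open>Gamma \<beta>\<close> is left in front of
        \<open>d l\<close>.\<close>
      define p where "p = \<alpha> * real l + \<gamma> + 1"
      have p: "1 \<le> p" using pos by (simp add: p_def)
      have "0 < Gamma p" by (rule Gamma_real_pos) (use p in simp)
      then have "Gamma p \<noteq> 0" by (rule less_imp_neq[THEN not_sym])
      moreover have "((\<lambda>s. ((t - s) powr (\<beta> - 1) * s powr (p - 1)) *\<^sub>R ((1 / Gamma p) *\<^sub>R (T ^^ l) w))
          has_integral (Beta p \<beta> * t powr (p + \<beta> - 1)) *\<^sub>R ((1 / Gamma p) *\<^sub>R (T ^^ l) w)) {0..t}"
        by (intro has_integral_scaleR_left has_integral_powr_convolution) (use p pos \<beta> in auto)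
      ultimately show ?thesis
        by (simp add: c_def d_def p_def Beta_def add_ac mult_ac)
    qed
    then show ?thesis
      by (simp only: scaleR_sum_right) (intro has_integral_sum, auto)
  qed
  have "(\<lambda>n. integral {0..t} (\<lambda>s. (t - s) powr (\<beta> - 1) *\<^sub>R (\<Sum>l<n. c l s)))
      \<longlonglongrightarrow> integral {0..t} (\<lambda>s. (t - s) powr (\<beta> - 1) *\<^sub>R mittag_leffler T \<alpha> \<gamma> w s)"
  proof (rule dominated_convergence(2))
    show "(\<lambda>s. (t - s) powr (\<beta> - 1) *\<^sub>R (\<Sum>l<n. c l s)) integrable_on {0..t}" for n
      using partial by blast
    \<comment> \<open>The dominating function is the singular kernel times a constant bounding all
      partial sums.\<close>
    show "(\<lambda>s. (t - s) powr (\<beta> - 1) *\<^sub>R suminf M) integrable_on {0..t}"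
      by (rule integrable_powr_kernel) (use \<beta> pos in auto)
    fix s assume s: "s \<in> {0..t}"
    show "norm ((t - s) powr (\<beta> - 1) *\<^sub>R (\<Sum>l<n. c l s)) \<le> (t - s) powr (\<beta> - 1) *\<^sub>R suminf M" for n
    proof -
      have "norm (\<Sum>l<n. c l s) \<le> (\<Sum>l<n. M l)"
        using cM[OF s] by (rule sum_norm_le)
      also have "\<dots> \<le> suminf M"
        using M order_trans[OF norm_ge_zero cM[OF s]] by (intro sum_le_suminf) auto
      finally show ?thesis by (simp add: mult_left_mono)
    qed
    have "(\<lambda>n. \<Sum>l<n. c l s) \<longlonglongrightarrow> mittag_leffler T \<alpha> \<gamma> w s"
      unfolding mittag_leffler_def c_def
      by (rule summable_LIMSEQ, rule summable_mittag_leffler) (use T pos s in auto)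
    then show "(\<lambda>n. (t - s) powr (\<beta> - 1) *\<^sub>R (\<Sum>l<n. c l s))
        \<longlonglongrightarrow> (t - s) powr (\<beta> - 1) *\<^sub>R mittag_leffler T \<alpha> \<gamma> w s"
      by (intro tendsto_intros)
  qed
  moreover have "(\<lambda>n. integral {0..t} (\<lambda>s. (t - s) powr (\<beta> - 1) *\<^sub>R (\<Sum>l<n. c l s)))
      \<longlonglongrightarrow> Gamma \<beta> *\<^sub>R mittag_leffler T \<alpha> (\<gamma> + \<beta>) w t"
  proof -
    have "(\<lambda>n. \<Sum>l<n. d l) \<longlonglongrightarrow> mittag_leffler T \<alpha> (\<gamma> + \<beta>) w t"
      unfolding mittag_leffler_def d_def
      by (rule summable_LIMSEQ, rule summable_mittag_leffler) (use T pos in auto)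
    then show ?thesis
      unfolding integral_unique[OF partial] by (intro tendsto_intros)
  qed
  ultimately have "integral {0..t} (\<lambda>s. (t - s) powr (\<beta> - 1) *\<^sub>R mittag_leffler T \<alpha> \<gamma> w s)
      = Gamma \<beta> *\<^sub>R mittag_leffler T \<alpha> (\<gamma> + \<beta>) w t"
    by (rule LIMSEQ_unique)
  moreover have "Gamma \<beta> \<noteq> 0" using Gamma_real_pos[OF \<beta>] by simp
  ultimately show ?thesis using False by (simp add: rl_integral_def)
qed

text \<open>The shift by 1 is fractional integration of order 1, that is, ordinary integration, so
  the fundamental theorem of calculus applies.\<close>

lemma has_vector_derivative_mittag_leffler:
  assumes T: "bounded_linear T" and pos: "0 < \<alpha>" "0 < \<gamma>" "0 \<le> t"
  shows "(mittag_leffler T \<alpha> (\<gamma> + 1) w has_vector_derivative mittag_leffler T \<alpha> \<gamma> w t)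
           (at t within {0..})"
proof (rule has_vector_derivative_transform)
  show "((\<lambda>s. integral {0..s} (mittag_leffler T \<alpha> \<gamma> w)) has_vector_derivative
          mittag_leffler T \<alpha> \<gamma> w t) (at t within {0..})"
    using T pos by (intro has_vector_derivative_integral_Ici continuous_on_mittag_leffler)
  fix s :: real assume s: "s \<in> {0..}"
  have "mittag_leffler T \<alpha> (\<gamma> + 1) w s = rl_integral 1 (mittag_leffler T \<alpha> \<gamma> w) s"
    using rl_integral_mittag_leffler[OF T pos(1,2), of 1 s w] s by simp
  also have "\<dots> = integral {0..s} (\<lambda>r. (s - r) powr 0 *\<^sub>R mittag_leffler T \<alpha> \<gamma> w r)"
    by (simp add: rl_integral_def)
  \<comment> \<open>The kernel \<open>(s - r) powr 0\<close> is 1 except at \<open>r = s\<close>,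
    where it is 0.\<close>
  also have "\<dots> = integral {0..s} (mittag_leffler T \<alpha> \<gamma> w)"
    by (rule integral_spike[of "{s}"]) auto
  finally show "mittag_leffler T \<alpha> (\<gamma> + 1) w s = integral {0..s} (mittag_leffler T \<alpha> \<gamma> w)" .
qed (use pos in auto)

lemma mittag_leffler_linear:
  assumes T: "bounded_linear T" and L: "bounded_linear L" and pos: "0 < \<alpha>" "0 \<le> \<gamma>" "0 \<le> t"
  shows "L (mittag_leffler T \<alpha> \<gamma> w t) =
    (\<Sum>l. (t powr (\<alpha> * real l + \<gamma>) / Gamma (\<alpha> * real l + \<gamma> + 1)) *\<^sub>R L ((T ^^ l) w))"
  using bounded_linear.suminf[OF L summable_mittag_leffler[OF T pos], of w]
  by (simp add: mittag_leffler_def bounded_linear.linear[OF L, THEN linear_scale])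

lemma mittag_leffler_apply:
  assumes "bounded_linear T" "0 < \<alpha>" "0 \<le> \<gamma>" "0 \<le> t"
  shows "T (mittag_leffler T \<alpha> \<gamma> w t) = mittag_leffler T \<alpha> \<gamma> (T w) t"
  using mittag_leffler_linear[OF assms(1,1) assms(2-4)]
  by (simp add: mittag_leffler_def funpow_swap1)

text \<open>
  The monomial has a natural-number exponent since \<open>0 powr 0 = 0\<close> would give the wrong value at
  \<open>t = 0\<close> in the case \<open>p = 0\<close>.
\<close>

definition mittag_leffler_flow ::
  "('a::euclidean_space \<Rightarrow> 'a) \<Rightarrow> real \<Rightarrow> nat \<Rightarrow> 'a \<Rightarrow> real \<Rightarrow> 'a" where
  "mittag_leffler_flow T \<alpha> p v t = (t ^ p / fact p) *\<^sub>R v + mittag_leffler T \<alpha> (real p + \<alpha>) (T v) t"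

text \<open>Split off the term \<open>l = 0\<close>; reindexing the rest moves one \<alpha> into the
  exponent and one \<open>T\<close> onto \<open>v\<close>. Positivity of \<open>p\<close> makes
  \<open>t powr p\<close> and \<open>t ^ p\<close> agree at \<open>t = 0\<close>.\<close>

lemma mittag_leffler_eq_flow:
  assumes "bounded_linear T" "0 < \<alpha>" "0 < p" "0 \<le> t"
  shows "mittag_leffler T \<alpha> (real p) v t = mittag_leffler_flow T \<alpha> p v t"
proof -
  define c where "c l = (t powr (\<alpha> * real l + real p) / Gamma (\<alpha> * real l + real p + 1)) *\<^sub>R (T ^^ l) v"
    for l
  have "summable c"
    unfolding c_def by (rule summable_mittag_leffler) (use assms in auto)
  then have "suminf c = c 0 + (\<Sum>l. c (Suc l))"
    by (simp add: suminf_split_head)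
  moreover have "c 0 = (t ^ p / fact p) *\<^sub>R v"
    using assms Gamma_fact[of p, where 'a = real]
    by (cases "t = 0") (auto simp: c_def powr_realpow add_ac)
  moreover have "(\<Sum>l. c (Suc l)) = mittag_leffler T \<alpha> (real p + \<alpha>) (T v) t"
    by (simp add: mittag_leffler_def c_def funpow_swap1 algebra_simps)
  moreover have "mittag_leffler T \<alpha> (real p) v t = suminf c"
    unfolding mittag_leffler_def
    by (rule arg_cong[where f = suminf], rule ext) (simp add: c_def)
  ultimately show ?thesis
    by (simp only: mittag_leffler_flow_def)
qed

lemma mittag_leffler_0: "mittag_leffler T \<alpha> \<gamma> w 0 = 0"
  by (simp add: mittag_leffler_def)

lemma continuous_on_mittag_leffler_flow:
  assumes "bounded_linear T" "0 < \<alpha>"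
  shows "continuous_on {0..} (mittag_leffler_flow T \<alpha> p v)"
  unfolding mittag_leffler_flow_def
  by (intro continuous_on_add continuous_on_mittag_leffler continuous_intros) (use assms in auto)

lemma has_vector_derivative_mittag_leffler_flow:
  assumes "bounded_linear T" "0 < \<alpha>" "0 \<le> t"
  shows "(mittag_leffler_flow T \<alpha> (Suc p) v has_vector_derivative mittag_leffler_flow T \<alpha> p v t)
           (at t within {0..})"
proof -
  have "((\<lambda>s. s ^ Suc p / fact (Suc p)) has_real_derivative
      (real (Suc p) * t ^ p) / fact (Suc p)) (at t within {0..})"
    by (rule DERIV_cdivide, rule DERIV_pow[THEN DERIV_cong]) simp
  also have "(real (Suc p) * t ^ p) / fact (Suc p) = t ^ p / fact p"
    by (simp add: divide_simps)
  finally have "((\<lambda>s. (s ^ Suc p / fact (Suc p)) *\<^sub>R v) has_vector_derivative (t ^ p / fact p) *\<^sub>R v)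
      (at t within {0..})"
    using has_vector_derivative_scaleR[OF _ has_vector_derivative_const] by fastforce
  moreover have "(mittag_leffler T \<alpha> (real (Suc p) + \<alpha>) (T v) has_vector_derivative
      mittag_leffler T \<alpha> (real p + \<alpha>) (T v) t) (at t within {0..})"
    using has_vector_derivative_mittag_leffler[of T \<alpha> "real p + \<alpha>" t "T v"] assms
    by (simp add: add_ac)
  ultimately show ?thesis
    unfolding mittag_leffler_flow_def by (rule has_vector_derivative_add)
qed

lemma mittag_leffler_flow_at_0: "mittag_leffler_flow T \<alpha> p v 0 = (if p = 0 then v else 0)"
  by (simp add: mittag_leffler_flow_def mittag_leffler_0)

section \<open>Explicit solutions for zero control\<close>

lemma ceil_order_pos: "0 < \<alpha> \<Longrightarrow> 0 < ceil_order \<alpha>"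
  by (simp add: ceil_order_def)

lemma le_ceil_order: "\<alpha> \<le> real (ceil_order \<alpha>)"
  by (simp add: ceil_order_def real_nat_ceiling_ge)

lemma hderiv_mittag_leffler_flow:
  assumes "bounded_linear T" "0 < \<alpha>" "i \<le> p" "0 \<le> t"
  shows "(hderiv ^^ i) (mittag_leffler_flow T \<alpha> p v) t = mittag_leffler_flow T \<alpha> (p - i) v t"
proof (rule hderiv_funpow_eqI[of _ "\<lambda>i. mittag_leffler_flow T \<alpha> (p - i) v" p])
  fix j s assume "j < p" "(0::real) \<le> s"
  then show "(mittag_leffler_flow T \<alpha> (p - j) v has_vector_derivative
      mittag_leffler_flow T \<alpha> (p - Suc j) v s) (at s within {0..})"
    using has_vector_derivative_mittag_leffler_flow[OF assms(1,2), of s "p - Suc j" v]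
    by (simp add: Suc_diff_Suc)
qed (use assms in auto)

lemma hsmooth_mittag_leffler_flow:
  assumes "bounded_linear T" "0 < \<alpha>" "r \<le> p"
    and "\<And>t. 0 \<le> t \<Longrightarrow> f t = mittag_leffler_flow T \<alpha> p v t"
  shows "hsmooth r f"
proof (rule hsmoothI[of _ "\<lambda>i. mittag_leffler_flow T \<alpha> (p - i) v"])
  fix j s assume "j < r" "(0::real) \<le> s"
  then show "(mittag_leffler_flow T \<alpha> (p - j) v has_vector_derivative
      mittag_leffler_flow T \<alpha> (p - Suc j) v s) (at s within {0..})"
    using has_vector_derivative_mittag_leffler_flow[OF assms(1,2), of s "p - Suc j" v] assms(3)
    by (simp add: Suc_diff_Suc)
qed (use assms in \<open>auto intro: continuous_on_mittag_leffler_flow\<close>)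

lemma apply_mittag_leffler_flow:
  assumes "bounded_linear T" "0 < \<alpha>" "0 \<le> t"
  shows "T (mittag_leffler_flow T \<alpha> p v t) = mittag_leffler_flow T \<alpha> p (T v) t"
  using assms
  by (simp add: mittag_leffler_flow_def mittag_leffler_apply bounded_linear.linear
      linear_add linear_scale)

text \<open>Subtracting the Taylor polynomial removes exactly the monomial of the flow. Integration
  of order \<open>k - \<alpha>\<close> turns the remaining exponent \<open>k - 1 + \<alpha>\<close>
  into the integer \<open>2 * k - 1\<close>, so the result is again a flow.\<close>

lemma caputo_pre_mittag_leffler_flow:
  fixes T :: "'a::euclidean_space \<Rightarrow> 'a"
  assumes T: "bounded_linear T" and \<alpha>: "0 < \<alpha>" and t: "0 \<le> t" and k: "k = ceil_order \<alpha>"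
  shows "caputo_pre \<alpha> (mittag_leffler_flow T \<alpha> (k - 1) v) t
           = mittag_leffler_flow T \<alpha> (2 * k - 1) (T v) t"
proof -
  have k0: "0 < k" using ceil_order_pos[OF \<alpha>] k by simp
  \<comment> \<open>The \<open>j\<close>-th derivative at 0 is the flow of index
    \<open>k - 1 - j\<close> at 0, which vanishes unless \<open>j = k - 1\<close>.\<close>
  have taylor: "(\<Sum>j<k. (s ^ j / fact j) *\<^sub>R (hderiv ^^ j) (mittag_leffler_flow T \<alpha> (k - 1) v) 0)
      = (s ^ (k - 1) / fact (k - 1)) *\<^sub>R v" for s :: real
  proof -
    have "(\<Sum>j<k. (s ^ j / fact j) *\<^sub>R (hderiv ^^ j) (mittag_leffler_flow T \<alpha> (k - 1) v) 0)
        = (\<Sum>j<k. if j = k - 1 then (s ^ (k - 1) / fact (k - 1)) *\<^sub>R v else 0)"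
      using T \<alpha> by (intro sum.cong)
        (auto simp: hderiv_mittag_leffler_flow mittag_leffler_flow_at_0)
    then show ?thesis using k0 by simp
  qed
  have "caputo_pre \<alpha> (mittag_leffler_flow T \<alpha> (k - 1) v) t
      = rl_integral (real k - \<alpha>) (mittag_leffler T \<alpha> (real (k - 1) + \<alpha>) (T v)) t"
    unfolding caputo_pre_def k[symmetric] taylor by (simp add: mittag_leffler_flow_def[abs_def])
  also have "\<dots> = mittag_leffler T \<alpha> (real (k - 1) + \<alpha> + (real k - \<alpha>)) (T v) t"
    using T \<alpha> t le_ceil_order[of \<alpha>] k
    by (intro rl_integral_mittag_leffler) (auto intro: add_nonneg_pos)
  also have "real (k - 1) + \<alpha> + (real k - \<alpha>) = real (2 * k - 1)"
    using k0 by (simp add: of_nat_diff)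
  also have "mittag_leffler T \<alpha> (real (2 * k - 1)) (T v) t
      = mittag_leffler_flow T \<alpha> (2 * k - 1) (T v) t"
    by (rule mittag_leffler_eq_flow) (use T \<alpha> t k0 in auto)
  finally show ?thesis .
qed

text \<open>Differentiating \<open>k\<close> times lowers the index \<open>2 * k - 1\<close> to
  \<open>k - 1\<close>, leaving the flow of \<open>A *v v\<close>, which is \<open>A\<close> applied
  to the flow of \<open>v\<close>.\<close>

lemma caputo_solution_mittag_leffler_flow:
  fixes A :: "real^'n^'n" and B :: "real^'m^'n"
  assumes \<alpha>: "0 < \<alpha>" and k: "k = ceil_order \<alpha>"
  shows "caputo_solution \<alpha> A B (\<lambda>_. 0) (\<lambda>j. if j = k - 1 then v else 0)
           (mittag_leffler_flow ((*v) A) \<alpha> (k - 1) v)"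
proof -
  let ?x = "mittag_leffler_flow ((*v) A) \<alpha> (k - 1) v"
  have T: "bounded_linear ((*v) A)" by (rule matrix_vector_mul_bounded_linear)
  have k0: "0 < k" using ceil_order_pos[OF \<alpha>] k by simp
  have pre: "caputo_pre \<alpha> ?x t = mittag_leffler_flow ((*v) A) \<alpha> (2 * k - 1) (A *v v) t"
    if "0 \<le> t" for t
    using caputo_pre_mittag_leffler_flow[OF T \<alpha> that k] .
  have pre_deriv: "(hderiv ^^ i) (caputo_pre \<alpha> ?x) t
      = mittag_leffler_flow ((*v) A) \<alpha> (2 * k - 1 - i) (A *v v) t" if "i \<le> k" "0 \<le> t" for i t
  proof -
    have "(hderiv ^^ i) (caputo_pre \<alpha> ?x) t
        = (hderiv ^^ i) (mittag_leffler_flow ((*v) A) \<alpha> (2 * k - 1) (A *v v)) t"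
      by (rule hderiv_funpow_cong[OF open_UNIV]) (use pre that in auto)
    then show ?thesis using T \<alpha> that k0 by (simp add: hderiv_mittag_leffler_flow)
  qed
  \<comment> \<open>Smoothness of order \<open>k\<close>, one more than a solution must have, yields
    Caputo differentiability at every point.\<close>
  have smooth: "hsmooth k (caputo_pre \<alpha> ?x)"
    by (rule hsmooth_mittag_leffler_flow[OF T \<alpha> _ pre]) (use k0 in auto)
  have "hsmooth (k - 1) ?x"
    by (rule hsmooth_mittag_leffler_flow[OF T \<alpha>]) auto
  moreover have "(hderiv ^^ j) ?x 0 = (if j = k - 1 then v else 0)" if "j < k" for j
    using that T \<alpha> by (auto simp: hderiv_mittag_leffler_flow mittag_leffler_flow_at_0)
  moreover have "hsmooth (k - 1) (caputo_pre \<alpha> ?x)"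
    by (rule hsmooth_mittag_leffler_flow[OF T \<alpha> _ pre]) auto
  moreover have "caputo_differentiable \<alpha> ?x t" if "0 < t" for t
    using smooth that k0 by (auto simp: caputo_differentiable_def hsmooth_def k[symmetric])
  moreover have "caputo_deriv \<alpha> ?x t = A *v ?x t + B *v 0" if "0 < t" for t
  proof -
    have "2 * k - 1 - k = k - 1" by simp
    then show ?thesis
      using pre_deriv[of k t] that \<alpha> apply_mittag_leffler_flow[OF T \<alpha>, of t "k - 1" v]
      by (simp add: caputo_deriv_def k[symmetric])
  qed
  ultimately show ?thesis
    by (simp add: caputo_solution_def k[symmetric])
qed

section \<open>Linear images of solutions\<close>

text \<open>The last differentiation is required only at the single point \<open>t\<close>: the top
  derivative in the Caputo equation is available only where the control is continuous.\<close>

lemma hderiv_funpow_Suc_linear: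
  assumes L: "bounded_linear L"
    and diff: "\<And>j s. j < i \<Longrightarrow> 0 \<le> s \<Longrightarrow> (hderiv ^^ j) f differentiable (at s within {0..})"
    and "(hderiv ^^ i) f differentiable (at t within {0..})" "0 \<le> t"
  shows "(hderiv ^^ Suc i) (\<lambda>s. L (f s)) t = L ((hderiv ^^ Suc i) f t)"
proof -
  have "((\<lambda>s. L ((hderiv ^^ i) f s)) has_vector_derivative L ((hderiv ^^ Suc i) f t))
      (at t within {0..})"
    using bounded_linear.has_vector_derivative[OF L has_vector_derivative_hderiv[OF assms(3)]]
    by simp
  then have "((hderiv ^^ i) (\<lambda>s. L (f s)) has_vector_derivative L ((hderiv ^^ Suc i) f t))
      (at t within {0..})"
    by (rule has_vector_derivative_transform[rotated 2])
       (use hderiv_funpow_linear[OF L diff] assms(4) in auto)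
  then show ?thesis using assms(4) by (simp add: hderiv_eqI)
qed

lemma hsmooth_imp_continuous_on:
  assumes "hsmooth r f"
  shows "continuous_on {0..} f"
proof (cases r)
  case 0
  then show ?thesis using assms by (simp add: hsmooth_def)
next
  case (Suc q)
  then have "f differentiable (at t within {0..})" if "0 \<le> t" for t
    using assms that by (force simp: hsmooth_def)
  then show ?thesis
    by (auto simp: continuous_on_eq_continuous_within intro: differentiable_imp_continuous_within)
qed

lemma rl_integral_linear:
  assumes "bounded_linear L" "continuous_on {0..} f" "0 \<le> \<beta>" "0 \<le> t"
  shows "rl_integral \<beta> (\<lambda>s. L (f s)) t = L (rl_integral \<beta> f t)"
proof (cases "\<beta> = 0")
  case False
  have "(\<lambda>s. (t - s) powr (\<beta> - 1) *\<^sub>R f s) integrable_on {0..t}"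
    using assms False by (intro integrable_powr_kernel) (auto intro: continuous_on_subset)
  from integral_linear[OF this assms(1)] show ?thesis
    using False assms(1)
    by (simp add: rl_integral_def o_def bounded_linear.linear linear_scale)
qed (simp add: rl_integral_def)

lemma rl_integral_cong:
  assumes "\<And>s. 0 \<le> s \<Longrightarrow> s \<le> t \<Longrightarrow> f s = g s" "0 \<le> t"
  shows "rl_integral \<beta> f t = rl_integral \<beta> g t"
proof -
  have "integral {0..t} (\<lambda>s. (t - s) powr (\<beta> - 1) *\<^sub>R f s)
      = integral {0..t} (\<lambda>s. (t - s) powr (\<beta> - 1) *\<^sub>R g s)"
    by (rule integral_cong) (simp add: assms(1))
  then show ?thesis using assms by (simp add: rl_integral_def)
qed

text \<open>Causality: \<open>L\<close> passes through the Taylor polynomial and the fractional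
  integral, and both are determined by values on \<open>{0..t}\<close>.\<close>

lemma caputo_pre_linear_cong:
  fixes L :: "'a::euclidean_space \<Rightarrow> 'b::euclidean_space"
  assumes L: "bounded_linear L"
    and x: "hsmooth (ceil_order \<alpha> - 1) x" and y: "hsmooth (ceil_order \<alpha> - 1) y"
    and eq: "\<And>s. 0 \<le> s \<Longrightarrow> s \<le> t \<Longrightarrow> L (x s) = L (y s)" and s: "0 \<le> s" "s \<le> t" and t: "0 < t"
  shows "L (caputo_pre \<alpha> x s) = L (caputo_pre \<alpha> y s)"
proof -
  let ?k = "ceil_order \<alpha>"
  let ?f = "\<lambda>x s. x s - (\<Sum>j<?k. (s ^ j / fact j) *\<^sub>R (hderiv ^^ j) x 0)"
  have init: "L ((hderiv ^^ j) x 0) = L ((hderiv ^^ j) y 0)" if "j < ?k" for j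
  proof -
    \<comment> \<open>Since \<open>t > 0\<close>, the open set \<open>{..<t}\<close> contains 0, so
      agreement on \<open>{0..t}\<close> fixes the derivatives there.\<close>
    have "(hderiv ^^ j) (\<lambda>s. L (x s)) 0 = (hderiv ^^ j) (\<lambda>s. L (y s)) 0"
      by (rule hderiv_funpow_cong[of "{..<t}"]) (use eq t in auto)
    moreover have "(hderiv ^^ j) (\<lambda>s. L (x s)) 0 = L ((hderiv ^^ j) x 0)"
      by (rule hderiv_funpow_linear[OF L]) (use x that in \<open>auto simp: hsmooth_def\<close>)
    moreover have "(hderiv ^^ j) (\<lambda>s. L (y s)) 0 = L ((hderiv ^^ j) y 0)"
      by (rule hderiv_funpow_linear[OF L]) (use y that in \<open>auto simp: hsmooth_def\<close>)
    ultimately show ?thesis by simp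
  qed
  have pre: "L (caputo_pre \<alpha> z s) = rl_integral (real ?k - \<alpha>) (\<lambda>s. L (?f z s)) s"
    if "hsmooth (?k - 1) z" for z
    unfolding caputo_pre_def using hsmooth_imp_continuous_on[OF that] s le_ceil_order[of \<alpha>]
    by (intro rl_integral_linear[OF L, symmetric] continuous_intros) auto
  have "L (?f x r) = L (?f y r)" if "0 \<le> r" "r \<le> t" for r
    using eq[OF that] init bounded_linear.linear[OF L]
    by (simp add: linear_diff linear_sum linear_scale)
  then show ?thesis
    unfolding pre[OF x] pre[OF y] using s by (intro rl_integral_cong) auto
qed

text \<open>The open interval without a finite set is still dense in \<open>{0..t}\<close>, so the
  continuous difference vanishes throughout, endpoints included.\<close>

lemma eq_on_Icc_if_eq_cofinitely:
  fixes f g :: "real \<Rightarrow> 'a::real_normed_vector"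
  assumes "finite E" "0 < t" "continuous_on {0..t} f" "continuous_on {0..t} g"
    and eq: "\<And>s. 0 < s \<Longrightarrow> s < t \<Longrightarrow> s \<notin> E \<Longrightarrow> f s = g s" and s: "s \<in> {0..t}"
  shows "f s = g s"
proof -
  let ?S = "{0<..<t} - E"
  have cl: "r \<in> closure ?S" if "r \<in> {0..t}" for r
  proof -
    have "r islimpt closure {0<..<t}" using that \<open>0 < t\<close> by simp
    then have "r islimpt {0<..<t}" by (simp only: limpt_of_closure)
    then have "r islimpt (E \<union> ?S)" by (rule islimpt_subset) auto
    then have "r islimpt ?S" using islimpt_Un_finite[OF \<open>finite E\<close>] by blast
    then show ?thesis by (simp add: closure_def)
  qed
  have "closure ?S \<subseteq> {0..t}" by (rule closure_minimal) auto
  then have "continuous_on (closure ?S) (\<lambda>s. f s - g s)"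
    using assms(3,4) by (auto intro: continuous_on_diff continuous_on_subset)
  then have "f s - g s = 0"
    by (rule continuous_constant_on_closure) (use eq cl s in auto)
  then show ?thesis by simp
qed

text \<open>Equal outputs under \<open>L\<close> have equal Caputo derivatives wherever the equation
  holds; the control is shared, so the term with \<open>B\<close> cancels and equality under
  \<open>L\<close> composed with \<open>A\<close> remains.\<close>

lemma caputo_solutions_output_step:
  fixes A :: "real^'n^'n" and B :: "real^'m^'n" and L :: "real^'n \<Rightarrow> 'a::euclidean_space"
  assumes L: "bounded_linear L" and \<alpha>: "0 < \<alpha>" and t: "0 < t" and u: "admissible_control u"
    and x: "caputo_solution \<alpha> A B u x0 x" and y: "caputo_solution \<alpha> A B u y0 y"
    and eq: "\<And>s. s \<in> {0..t} \<Longrightarrow> L (x s) = L (y s)"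
    and s: "s \<in> {0..t}"
  shows "L (A *v x s) = L (A *v y s)"
proof (rule eq_on_Icc_if_eq_cofinitely[OF _ t _ _ _ s])
  let ?k = "ceil_order \<alpha>"
  let ?E = "{s \<in> {0..t}. \<not> continuous (at s within {0..}) u}"
  show "finite ?E" using u t by (auto simp: admissible_control_def)
  have cont: "continuous_on {0..t} (\<lambda>s. L (A *v z s))"
    if "caputo_solution \<alpha> A B u z0 z" for z0 z
  proof -
    have "continuous_on {0..} z"
      using that hsmooth_imp_continuous_on by (auto simp: caputo_solution_def)
    then have "continuous_on {0..t} z" by (rule continuous_on_subset) auto
    then show ?thesis
      by (rule bounded_linear.continuous_on[OF
            bounded_linear_compose[OF L matrix_vector_mul_bounded_linear[of A]]])
  qed
  from cont[OF x] show "continuous_on {0..t} (\<lambda>s. L (A *v x s))" .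
  from cont[OF y] show "continuous_on {0..t} (\<lambda>s. L (A *v y s))" .
  fix r assume r: "0 < r" "r < t" "r \<notin> ?E"
  have top: "(hderiv ^^ ?k) (\<lambda>s. L (caputo_pre \<alpha> z s)) r = L (A *v z r + B *v u r)"
    if z: "caputo_solution \<alpha> A B u z0 z" for z0 z
  proof -
    have Suc: "Suc (?k - 1) = ?k" using ceil_order_pos[OF \<alpha>] by simp
    have "continuous (at r within {0..}) u" using r by auto
    then have "caputo_differentiable \<alpha> z r" "caputo_deriv \<alpha> z r = A *v z r + B *v u r"
      using z r by (auto simp: caputo_solution_def)
    moreover have "(hderiv ^^ Suc (?k - 1)) (\<lambda>s. L (caputo_pre \<alpha> z s)) r
        = L ((hderiv ^^ Suc (?k - 1)) (caputo_pre \<alpha> z) r)"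
      by (rule hderiv_funpow_Suc_linear[OF L])
         (use z r calculation in \<open>auto simp: caputo_solution_def hsmooth_def caputo_differentiable_def\<close>)
    ultimately show ?thesis
      by (simp only: Suc caputo_deriv_def)
  qed
  have "(hderiv ^^ ?k) (\<lambda>s. L (caputo_pre \<alpha> x s)) r = (hderiv ^^ ?k) (\<lambda>s. L (caputo_pre \<alpha> y s)) r"
  \<comment> \<open>Here \<open>r < t\<close> matters: the two functions agree only up to
    \<open>t\<close>, and the derivative at \<open>r\<close> needs a full neighbourhood.\<close>
  proof (rule hderiv_funpow_cong[of "{..<t}"])
    fix q assume "q \<in> {..<t}" "0 \<le> q"
    then show "L (caputo_pre \<alpha> x q) = L (caputo_pre \<alpha> y q)"
      using x y eq t by (intro caputo_pre_linear_cong[OF L, where t = t]) (auto simp: caputo_solution_def)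
  qed (use r in auto)
  then show "L (A *v x r) = L (A *v y r)"
    unfolding top[OF x] top[OF y] by (simp add: linear_add[OF bounded_linear.linear[OF L]])
qed

section \<open>Equivalence with Kalman's condition\<close>

text \<open>The unobservable subspace is trivial. All powers of \<open>A\<close> are listed,
  matching both the iterated output equations and the terms of the series.\<close>

definition kalman_observable :: "real^'n^'n \<Rightarrow> real^'n^'z \<Rightarrow> bool" where
  "kalman_observable A C \<longleftrightarrow> (\<forall>v. (\<forall>l. C *v (((*v) A ^^ l) v) = 0) \<longrightarrow> v = 0)"

lemma bounded_linear_funpow:
  fixes T :: "'a::real_normed_vector \<Rightarrow> 'a"
  assumes "bounded_linear T"
  shows "bounded_linear (T ^^ l)"
proof (induction l)
  case 0
  show ?case by (simp add: id_def)
next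
  case (Suc l)
  from bounded_linear_compose[OF assms Suc] show ?case by (simp add: o_def)
qed

lemma kalman_imp_observable:
  fixes A :: "real^'n^'n" and B :: "real^'m^'n" and C :: "real^'n^'z"
  assumes \<alpha>: "0 < \<alpha>" and t: "0 < t" and kalman: "kalman_observable A C"
  shows "observable \<alpha> A B C t"
  unfolding observable_def
proof (intro allI impI)
  fix u x0 y0 x y j
  assume u: "admissible_control u"
    and x: "caputo_solution \<alpha> A B u x0 x" and y: "caputo_solution \<alpha> A B u y0 y"
    and out: "\<forall>\<tau>\<in>{0..t}. C *v x \<tau> = C *v y \<tau>" and j: "j < ceil_order \<alpha>"
  have A: "bounded_linear ((*v) A)" and C: "bounded_linear ((*v) C)"
    by (rule matrix_vector_mul_bounded_linear)+
  have L: "bounded_linear (\<lambda>v. C *v (((*v) A ^^ l) v))" for l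
    by (rule bounded_linear_compose[OF C bounded_linear_funpow[OF A]])
  have outs: "C *v (((*v) A ^^ l) (x s)) = C *v (((*v) A ^^ l) (y s))" if "s \<in> {0..t}" for l s
    using that
  proof (induction l arbitrary: s)
    case 0
    then show ?case using out by simp
  next
    case (Suc l)
    \<comment> \<open>The step lemma, applied to \<open>C\<close> after the \<open>l\<close>-th
      power of \<open>A\<close>, appends one further factor \<open>A\<close>.\<close>
    from caputo_solutions_output_step[OF L[of l] \<alpha> t u x y Suc.IH Suc.prems]
    show ?case by (simp add: funpow_swap1)
  qed
  have xy: "x s = y s" if "s \<in> {0..t}" for s
  proof -
    have "C *v (((*v) A ^^ l) (x s - y s)) = 0" for l
      using outs[OF that, of l] linear_diff[OF bounded_linear.linear[OF L[of l]], of "x s" "y s"]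
      by simp
    then show ?thesis using kalman by (fastforce simp: kalman_observable_def)
  qed
  \<comment> \<open>Agreement on any interval of positive length starting at 0 already determines
    the initial values.\<close>
  have "(hderiv ^^ j) x 0 = (hderiv ^^ j) y 0"
    by (rule hderiv_funpow_cong[of "{..<t}"]) (use xy t in auto)
  then show "x0 j = y0 j" using x y j by (simp add: caputo_solution_def)
qed

text \<open>The flows of \<open>v\<close> and of 0 both have zero output under zero control, so
  observability equates their initial data.\<close>

lemma observable_imp_kalman:
  fixes A :: "real^'n^'n" and B :: "real^'m^'n" and C :: "real^'n^'z"
  assumes \<alpha>: "0 < \<alpha>" and obs: "observable \<alpha> A B C t"
  shows "kalman_observable A C"
  unfolding kalman_observable_def
proof (intro allI impI)
  fix v :: "real^'n" assume v: "\<forall>l. C *v (((*v) A ^^ l) v) = 0"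
  define k where "k = ceil_order \<alpha>"
  let ?x = "mittag_leffler_flow ((*v) A) \<alpha> (k - 1)"
  have A: "bounded_linear ((*v) A)" and C: "bounded_linear ((*v) C)"
    by (rule matrix_vector_mul_bounded_linear)+
  have u: "admissible_control (\<lambda>_. 0 :: real^'m)"
    by (auto simp: admissible_control_def image_constant_conv)
  have out: "C *v ?x w \<tau> = 0" if "\<forall>l. C *v (((*v) A ^^ l) w) = 0" "0 \<le> \<tau>" for w \<tau>
  proof -
    \<comment> \<open>The series part of the flow starts from \<open>A *v w\<close>, so the
      hypothesis is used at index \<open>Suc l\<close>; index 0 handles the monomial.\<close>
    have "C *v (((*v) A ^^ l) (A *v w)) = 0" for l
      using that(1)[rule_format, of "Suc l"] by (simp add: funpow_swap1)
    then have "C *v mittag_leffler ((*v) A) \<alpha> (real (k - 1) + \<alpha>) (A *v w) \<tau> = 0"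
      using mittag_leffler_linear[OF A C \<alpha>, of "real (k - 1) + \<alpha>" \<tau> "A *v w"] \<alpha> that(2) by simp
    moreover have "C *v w = 0" using that(1)[rule_format, of 0] by simp
    ultimately show ?thesis
      by (simp add: mittag_leffler_flow_def matrix_vector_right_distrib scaleR_matrix_vector_assoc
          matrix_vector_mult_scaleR)
  qed
  have zero: "\<forall>l. C *v (((*v) A ^^ l) 0) = 0"
    using linear_0[OF bounded_linear.linear[OF bounded_linear_funpow[OF A]]] by simp
  \<comment> \<open>These are the two initial data at \<open>j = k - 1\<close>, the only index where
    they can differ, in the form in which the solutions were stated.\<close>
  have "(if k - 1 = k - 1 then v else 0) = (if k - 1 = k - 1 then 0 else 0)"
    using obs[unfolded observable_def, rule_format, OF u
        caputo_solution_mittag_leffler_flow[OF \<alpha> k_def, of A B v]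
        caputo_solution_mittag_leffler_flow[OF \<alpha> k_def, of A B 0], of "k - 1"]
      out[OF v] out[OF zero] ceil_order_pos[OF \<alpha>]
    by (simp add: k_def)
  then show "v = 0" by simp
qed

theorem corollary4p4:
  fixes A :: "real^'n^'n" and B :: "real^'m^'n" and C :: "real^'n^'z"
    and \<alpha> \<alpha>' t t' :: real
  assumes "CARD('z) \<le> CARD('n)"
    and "\<alpha> > 0" and "\<alpha>' > 0" and "t > 0" and "t' > 0"
  shows "observable \<alpha> A B C t \<longleftrightarrow> observable \<alpha>' A B C t'"
  using assms observable_imp_kalman kalman_imp_observable by blast

end
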